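(* Let $\&$ be the product t-norm. A net $\{u_i\}_{i\in D}$ in $\mathbb{E}^1$ $S_{*}$-converges to $u\in\mathbb{E}^1$ if and only if for every $\varepsilon>0$ there exists $i_0\in D$ such that for all $i\ge i_0$ and all $x\in\mathbb{R}$, $$u_i(x)=u(x)=0\quad\text{or}\quad\frac{\min(u_i(x),u(x))}{\max(u_i(x),u(x))}>1-\varepsilon.$$
   Context: The product t-norm is $a\,\&\,b=ab$ on $[0,1]$, with residuated implication $a\rightarrow c=c/a$ if $a>c$ and $a\rightarrow c=1$ otherwise. Fuzzy numbers: $\mathbb{E}^1$ is the set of all $u:\mathbb{R}\to[0,1]$ such that (1) $u(x_0)=1$ for some $x_0$; (2) $u(\lambda x+(1-\lambda)y)\ge\min\{u(x),u(y)\}$ for all $x,y\in\mathbb{R}$, $\lambda\in[0,1]$; (3) $u$ is upper semicontinuous; (4) $[u]_0=\overline{\{x: u(x)>0\}}$ is compact. Write $[u]_0=[u_0^-,u_0^+]$ and $[u]_1=\{x:u(x)=1\}=[u_1^-,u_1^+]$. The left part $u^\ell$ and right part $u^r$ are functions $\mathbb{R}\to[0,1]$: $u^\ell(x)=0$ for $x<u_0^-$, $u^\ell(x)=u(x)$ for $x\in[u_0^-,u_1^-]$, $u^\ell(x)=1$ for $x>u_1^-$; and $u^r(x)=1$ for $x<u_1^-$, $u^r(x)=u(x)$ for $x\in[u_1^-,u_0^+]$, $u^r(x)=0$ for $x>u_0^+$. For $u,v\in\mathbb{E}^1$: $P(u,v)=\inf_{x\in\mathbb{R}}\left[(v^\ell(x)\rightarrow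 u^\ell(x))\wedge(u^r(x)\rightarrow v^r(x))\right]$ and $S_{*}(u,v)=P(u,v)\wedge P(v,u)$, using the product implication. A net $\{u_i\}_{i\in D}$ in $\mathbb{E}^1$ $S_{*}$-converges to $u\in\mathbb{E}^1$ if $\sup_{i\in D}\inf_{j\ge i}S_{*}(u,u_j)=1$ (equivalently, it converges to $u$ in the topology with base the balls $\{v: S_{*}(w,v)>r\}$, $w\in\mathbb{E}^1$, $r<1$). *)

theory Defs
  imports "HOL-Analysis.Analysis"
begin

definition upper_semicontinuous :: "(real \<Rightarrow> real) \<Rightarrow> bool" where
  "upper_semicontinuous f \<longleftrightarrow> (\<forall>x. \<forall>c>f x. \<forall>\<^sub>F y in nhds x. f y < c)"

definition support_closure :: "(real \<Rightarrow> real) \<Rightarrow> real set" where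
  "support_closure u = closure {x. u x > 0}"

definition core :: "(real \<Rightarrow> real) \<Rightarrow> real set" where
  "core u = {x. u x = 1}"

definition fuzzy_numbers :: "(real \<Rightarrow> real) set" where
  "fuzzy_numbers = {u.
     (\<forall>x. u x \<in> {0..1}) \<and>
     (\<exists>x. u x = 1) \<and>
     (\<forall>x y. \<forall>t\<in>{0..1}. u (t * x + (1 - t) * y) \<ge> min (u x) (u y)) \<and>
     upper_semicontinuous u \<and>
     compact (support_closure u)}"

text \<open>
  For a fuzzy number, the closed support and the core are nonempty compact intervals; the
  following are their end points.
\<close>

definition supp_lo :: "(real \<Rightarrow> real) \<Rightarrow> real" where
  "supp_lo u = Inf (support_closure u)"

definition supp_hi :: "(real \<Rightarrow> real) \<Rightarrow> real" where
  "supp_hi u = Sup (support_closure u)"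

definition core_lo :: "(real \<Rightarrow> real) \<Rightarrow> real" where
  "core_lo u = Inf (core u)"

definition left_part :: "(real \<Rightarrow> real) \<Rightarrow> real \<Rightarrow> real" where
  "left_part u x = (if x < supp_lo u then 0 else if x \<le> core_lo u then u x else 1)"

definition right_part :: "(real \<Rightarrow> real) \<Rightarrow> real \<Rightarrow> real" where
  "right_part u x = (if x < core_lo u then 1 else if x \<le> supp_hi u then u x else 0)"

definition product_imp :: "real \<Rightarrow> real \<Rightarrow> real" where
  "product_imp a c = (if a > c then c / a else 1)"

lemma product_imp_residuated:
  assumes "a \<in> {0..1}" "b \<in> {0..1}" "c \<in> {0..1}"
  shows "a * b \<le> c \<longleftrightarrow> b \<le> product_imp a c"
proof (cases "a > c")
  case True
  then show ?thesis
    using assms by (simp add: product_imp_def field_simps)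
next
  case False
  then show ?thesis
    using assms mult_left_le[of b a] by (simp add: product_imp_def)
qed

text \<open>
  On fuzzy numbers all values below lie in $[0,1]$, and the index sets of the infima and suprema
  are nonempty, so the infima and suprema of reals are the intended ones.
\<close>

definition fuzzy_P :: "(real \<Rightarrow> real) \<Rightarrow> (real \<Rightarrow> real) \<Rightarrow> real" where
  "fuzzy_P u v =
     (INF x. min (product_imp (left_part v x) (left_part u x))
                 (product_imp (right_part u x) (right_part v x)))"

definition fuzzy_S :: "(real \<Rightarrow> real) \<Rightarrow> (real \<Rightarrow> real) \<Rightarrow> real" where
  "fuzzy_S u v = min (fuzzy_P u v) (fuzzy_P v u)"

definition directed_set :: "'i set \<Rightarrow> ('i \<Rightarrow> 'i \<Rightarrow> bool) \<Rightarrow> bool" where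
  "directed_set D le \<longleftrightarrow> D \<noteq> {} \<and> reflp_on D le \<and> transp_on D le \<and>
     (\<forall>i\<in>D. \<forall>j\<in>D. \<exists>k\<in>D. le i k \<and> le j k)"

definition S_converges ::
  "'i set \<Rightarrow> ('i \<Rightarrow> 'i \<Rightarrow> bool) \<Rightarrow> ('i \<Rightarrow> real \<Rightarrow> real) \<Rightarrow> (real \<Rightarrow> real) \<Rightarrow> bool" where
  "S_converges D le U u \<longleftrightarrow> (SUP i\<in>D. INF j\<in>{j\<in>D. le i j}. fuzzy_S u (U j)) = 1"

end

theory Submission
  imports Defs
begin

text \<open>
  The residuation property of the product turns a lower bound \<open>r \<le> fuzzy_S u v\<close> with
  \<open>r \<in> [0,1]\<close> into the statement that, at every point, each of the two left parts is at least
  \<open>r\<close> times the other one, and likewise for the right parts. The heart of the matter is that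
  the parts can be replaced by the fuzzy numbers themselves
  (\<open>le_fuzzy_S_iff\<close>). One direction holds because a fuzzy number is the minimum of its
  two parts. For the other, the parts of \<open>u\<close> and \<open>v\<close> at \<open>x\<close> can fail to be given by the values
  \<open>u x\<close> and \<open>v x\<close> in an essential way only if \<open>x\<close> lies between the left end points of the two
  cores; there \<open>v\<close> is at least \<open>r\<close>, by convexity, because it is \<open>1\<close> at one of these end points
  and at least \<open>r * u = r\<close> at the other one.

  Hence \<open>fuzzy_S u v\<close> is the largest \<open>r \<le> 1\<close> with \<open>r * u \<le> v\<close> and \<open>r * v \<le> u\<close> everywhere, that
  is, with \<open>r * max (u x) (v x) \<le> min (u x) (v x)\<close> for every \<open>x\<close>. Up to the difference between
  strict and non-strict inequalities, which a change of \<open>\<epsilon>\<close> absorbs, convergence of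
  \<open>fuzzy_S u (U i)\<close> to \<open>1\<close> is therefore the asserted uniform condition on quotients.
\<close>

section \<open>Fuzzy numbers and their two parts\<close>

lemma fuzzy_numberD:
  assumes "u \<in> fuzzy_numbers"
  shows fuzzy_number_unit_interval: "\<forall>x. u x \<in> {0..1}"
    and fuzzy_number_normal: "\<exists>x. u x = 1"
    and fuzzy_number_quasiconcave:
      "\<forall>x y. \<forall>t\<in>{0..1}. u (t * x + (1 - t) * y) \<ge> min (u x) (u y)"
    and fuzzy_number_usc: "upper_semicontinuous u"
    and fuzzy_number_compact_support: "compact (support_closure u)"
  using assms unfolding fuzzy_numbers_def mem_Collect_eq by blast+

lemma fuzzy_number_range:
  assumes "u \<in> fuzzy_numbers"
  shows "0 \<le> u x" "u x \<le> 1"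
  using fuzzy_number_unit_interval[OF assms] by simp_all

lemma fuzzy_number_between:
  assumes "u \<in> fuzzy_numbers" "a \<le> x" "x \<le> b"
  shows "min (u a) (u b) \<le> u x"
proof (cases "a = b")
  case True
  then show ?thesis using assms by auto
next
  case False
  then have "a < b" using assms by simp
  define t where "t = (b - x) / (b - a)"
  have t: "t \<in> {0..1}" using assms \<open>a < b\<close> by (auto simp: t_def field_simps)
  have "t * (b - a) = b - x" using \<open>a < b\<close> by (simp add: t_def)
  then have "t * a + (1 - t) * b = x" by (simp add: algebra_simps)
  moreover have "min (u a) (u b) \<le> u (t * a + (1 - t) * b)"
    using fuzzy_number_quasiconcave[OF assms(1)] t by blast
  ultimately show ?thesis by simp
qed

lemma fuzzy_number_zero_outside_support:
  assumes "u \<in> fuzzy_numbers" "x < supp_lo u \<or> supp_hi u < x"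
  shows "u x = 0"
proof (rule ccontr)
  assume "u x \<noteq> 0"
  then have "u x > 0" using fuzzy_number_range[OF assms(1), of x] by simp
  then have mem: "x \<in> support_closure u"
    unfolding support_closure_def using closure_subset[of "{x. u x > 0}"] by auto
  have "bounded (support_closure u)"
    using fuzzy_number_compact_support[OF assms(1)] by (rule compact_imp_bounded)
  then have "supp_lo u \<le> x" "x \<le> supp_hi u"
    using mem unfolding supp_lo_def supp_hi_def
    by (auto intro: cInf_lower cSup_upper bounded_imp_bdd_below bounded_imp_bdd_above)
  then show False using assms(2) by linarith
qed

text \<open>
  The left end point of the core is attained: upper semicontinuity makes the set where \<open>u < 1\<close>
  open, so the core is closed.
\<close>

lemma fuzzy_number_core_lo:
  assumes "u \<in> fuzzy_numbers"
  shows "u (core_lo u) = 1"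
proof -
  have "open {x. u x < 1}"
  proof (subst open_subopen, intro ballI)
    fix x assume "x \<in> {x. u x < 1}"
    then have "\<forall>\<^sub>F y in nhds x. u y < 1"
      using fuzzy_number_usc[OF assms] by (simp add: upper_semicontinuous_def)
    then show "\<exists>T. open T \<and> x \<in> T \<and> T \<subseteq> {x. u x < 1}"
      unfolding eventually_nhds by blast
  qed
  moreover have "core u = - {x. u x < 1}"
    using fuzzy_number_range(2)[OF assms] by (auto simp: core_def not_less intro: antisym)
  ultimately have "closed (core u)" by (simp add: closed_def)
  moreover have "core u \<noteq> {}" using fuzzy_number_normal[OF assms] by (simp add: core_def)
  moreover have "bdd_below (core u)"
  proof -
    have "core u \<subseteq> support_closure u"
      unfolding core_def support_closure_def using closure_subset[of "{x. u x > 0}"] by auto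
    moreover have "bounded (support_closure u)"
      using fuzzy_number_compact_support[OF assms] by (rule compact_imp_bounded)
    ultimately show ?thesis by (meson bounded_subset bounded_imp_bdd_below)
  qed
  ultimately have "core_lo u \<in> core u"
    unfolding core_lo_def by (intro closed_contains_Inf)
  then show ?thesis by (simp add: core_def)
qed

text \<open>
  A fuzzy number vanishes outside its closed support, so the case distinction at the ends of the
  support disappears from the two parts.
\<close>

lemma left_part_fuzzy_number:
  assumes "u \<in> fuzzy_numbers"
  shows "left_part u x = (if x \<le> core_lo u then u x else 1)"
proof -
  have "supp_lo u \<le> core_lo u"
    using fuzzy_number_zero_outside_support[OF assms, of "core_lo u"]
      fuzzy_number_core_lo[OF assms] by force
  then show ?thesis
    using fuzzy_number_zero_outside_support[OF assms, of x] by (auto simp: left_part_def)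
qed

lemma right_part_fuzzy_number:
  assumes "u \<in> fuzzy_numbers"
  shows "right_part u x = (if x < core_lo u then 1 else u x)"
  using fuzzy_number_zero_outside_support[OF assms, of x] by (auto simp: right_part_def)

lemma fuzzy_number_eq_min_parts:
  assumes "u \<in> fuzzy_numbers"
  shows "u x = min (left_part u x) (right_part u x)"
  using fuzzy_number_range(2)[OF assms, of x] fuzzy_number_core_lo[OF assms]
  by (auto simp: left_part_fuzzy_number[OF assms] right_part_fuzzy_number[OF assms])

lemma parts_range:
  assumes "u \<in> fuzzy_numbers"
  shows "left_part u x \<in> {0..1}" "right_part u x \<in> {0..1}"
  using fuzzy_number_range[OF assms]
  by (auto simp: left_part_fuzzy_number[OF assms] right_part_fuzzy_number[OF assms])

section \<open>Lower bounds for the similarity of two fuzzy numbers\<close>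

lemma product_imp_range:
  assumes "a \<in> {0..1}" "c \<in> {0..1}"
  shows "product_imp a c \<in> {0..1}"
  using assms by (auto simp: product_imp_def divide_le_eq)

lemma bdd_below_fuzzy_P:
  assumes "u \<in> fuzzy_numbers" "v \<in> fuzzy_numbers"
  shows "bdd_below (range (\<lambda>x. min (product_imp (left_part v x) (left_part u x))
                                  (product_imp (right_part u x) (right_part v x))))"
proof (rule bdd_belowI2[where m = 0])
  fix x
  show "0 \<le> min (product_imp (left_part v x) (left_part u x))
                (product_imp (right_part u x) (right_part v x))"
    using product_imp_range[OF parts_range(1)[OF assms(2)] parts_range(1)[OF assms(1)], of x x]
      product_imp_range[OF parts_range(2)[OF assms(1)] parts_range(2)[OF assms(2)], of x x]
    by simp
qed

lemma le_fuzzy_P_iff: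
  assumes "u \<in> fuzzy_numbers" "v \<in> fuzzy_numbers" "r \<in> {0..1}"
  shows "r \<le> fuzzy_P u v \<longleftrightarrow>
    (\<forall>x. r * left_part v x \<le> left_part u x \<and> r * right_part u x \<le> right_part v x)"
proof -
  have imp: "r \<le> product_imp a c \<longleftrightarrow> r * a \<le> c" if "a \<in> {0..1}" "c \<in> {0..1}" for a c
    using product_imp_residuated[OF that(1) assms(3) that(2)] by (simp add: mult.commute)
  show ?thesis
    unfolding fuzzy_P_def using bdd_below_fuzzy_P[OF assms(1,2)]
    by (simp add: le_cINF_iff imp[OF parts_range(1)[OF assms(2)] parts_range(1)[OF assms(1)]]
        imp[OF parts_range(2)[OF assms(1)] parts_range(2)[OF assms(2)]])
qed

lemma fuzzy_P_le_1:
  assumes "u \<in> fuzzy_numbers" "v \<in> fuzzy_numbers"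
  shows "fuzzy_P u v \<le> 1"
  unfolding fuzzy_P_def
proof (rule cINF_lower2[OF bdd_below_fuzzy_P[OF assms], of 0])
  show "min (product_imp (left_part v 0) (left_part u 0))
            (product_imp (right_part u 0) (right_part v 0)) \<le> 1"
    using product_imp_range[OF parts_range(1)[OF assms(2)] parts_range(1)[OF assms(1)], of 0 0]
    by (simp add: min_le_iff_disj)
qed simp

text \<open>
  This is where convexity enters. Of the four combinations of branches, the ones with a part of
  \<open>v\<close> equal to \<open>1\<close> or with both parts given by the functions themselves are immediate; in the
  remaining one, \<open>x\<close> lies between \<open>core_lo u\<close> and \<open>core_lo v\<close>, where \<open>v\<close> is at least \<open>r\<close>.
\<close>

lemma parts_mult_le:
  assumes u: "u \<in> fuzzy_numbers" and v: "v \<in> fuzzy_numbers" and r: "r \<in> {0..1}"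
    and le: "\<And>x. r * u x \<le> v x"
  shows "r * left_part u x \<le> left_part v x" "r * right_part u x \<le> right_part v x"
proof -
  have "r \<le> v (core_lo u)" using le[of "core_lo u"] fuzzy_number_core_lo[OF u] by simp
  then have endpoints: "r \<le> min (v (core_lo u)) (v (core_lo v))"
    using fuzzy_number_core_lo[OF v] r by simp
  have between: "r \<le> v x" if "core_lo u \<le> x \<and> x \<le> core_lo v \<or> core_lo v \<le> x \<and> x \<le> core_lo u"
    using that endpoints fuzzy_number_between[OF v, of "core_lo u" x "core_lo v"]
      fuzzy_number_between[OF v, of "core_lo v" x "core_lo u"] by linarith
  have bound: "r * u x \<le> 1" using le[of x] fuzzy_number_range(2)[OF v, of x] by linarith
  show "r * left_part u x \<le> left_part v x"
    using le[of x] bound between r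
    by (auto simp: left_part_fuzzy_number[OF u] left_part_fuzzy_number[OF v])
  show "r * right_part u x \<le> right_part v x"
    using le[of x] bound between r
    by (auto simp: right_part_fuzzy_number[OF u] right_part_fuzzy_number[OF v])
qed

lemma mult_le_of_parts:
  assumes "u \<in> fuzzy_numbers" "v \<in> fuzzy_numbers" "0 \<le> r"
    and "r * left_part u x \<le> left_part v x" "r * right_part u x \<le> right_part v x"
  shows "r * u x \<le> v x"
proof -
  have "r * u x \<le> r * left_part u x" "r * u x \<le> r * right_part u x"
    using assms(3) fuzzy_number_eq_min_parts[OF assms(1), of x]
    by (auto intro!: mult_left_mono)
  then show ?thesis
    using assms(4,5) fuzzy_number_eq_min_parts[OF assms(2), of x] by simp
qed

lemma le_fuzzy_S_iff:
  assumes u: "u \<in> fuzzy_numbers" and v: "v \<in> fuzzy_numbers" and r: "r \<in> {0..1}"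
  shows "r \<le> fuzzy_S u v \<longleftrightarrow> (\<forall>x. r * u x \<le> v x \<and> r * v x \<le> u x)"
proof -
  have "r \<le> fuzzy_S u v \<longleftrightarrow>
    (\<forall>x. (r * left_part u x \<le> left_part v x \<and> r * right_part u x \<le> right_part v x) \<and>
         (r * left_part v x \<le> left_part u x \<and> r * right_part v x \<le> right_part u x))"
    by (auto simp: fuzzy_S_def le_fuzzy_P_iff[OF u v r] le_fuzzy_P_iff[OF v u r])
  also have "\<dots> \<longleftrightarrow> (\<forall>x. r * u x \<le> v x \<and> r * v x \<le> u x)"
    using r parts_mult_le[OF u v r] parts_mult_le[OF v u r]
      mult_le_of_parts[OF u v] mult_le_of_parts[OF v u] by auto
  finally show ?thesis .
qed

lemma fuzzy_S_range:
  assumes "u \<in> fuzzy_numbers" "v \<in> fuzzy_numbers"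
  shows "fuzzy_S u v \<in> {0..1}"
proof -
  have "0 \<le> fuzzy_S u v"
    using le_fuzzy_S_iff[OF assms, of 0] fuzzy_number_range(1) assms by simp
  moreover have "fuzzy_S u v \<le> 1"
    using fuzzy_P_le_1[OF assms] by (simp add: fuzzy_S_def min_le_iff_disj)
  ultimately show ?thesis by simp
qed

section \<open>Convergence of nets\<close>

text \<open>
  For \<open>[0,1]\<close>-valued nets, an iterated supremum and infimum equal to \<open>1\<close> means convergence to
  \<open>1\<close>. Reflexivity of the order makes every tail nonempty, without which the infimum over a tail
  would be an unspecified real.
\<close>

lemma SUP_INF_eq_1_iff:
  fixes f :: "'i \<Rightarrow> real"
  assumes D: "directed_set D le" and f: "\<And>i. i \<in> D \<Longrightarrow> f i \<in> {0..1}"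
  shows "(SUP i\<in>D. INF j\<in>{j\<in>D. le i j}. f j) = 1 \<longleftrightarrow>
    (\<forall>r\<in>{0..<1}. \<exists>i\<in>D. \<forall>j\<in>D. le i j \<longrightarrow> r \<le> f j)"
proof -
  let ?g = "\<lambda>i. INF j\<in>{j\<in>D. le i j}. f j"
  have ne: "D \<noteq> {}" using D by (simp add: directed_set_def)
  have refl: "i \<in> {j\<in>D. le i j}" if "i \<in> D" for i
    using D that by (auto simp: directed_set_def reflp_on_def)
  have bdd: "bdd_below (f ` {j\<in>D. le i j})" for i
    by (rule bdd_belowI2[where m = 0]) (use f in auto)
  have INF_iff: "r \<le> ?g i \<longleftrightarrow> (\<forall>j\<in>D. le i j \<longrightarrow> r \<le> f j)" if "i \<in> D" for r i
  proof -
    have "{j\<in>D. le i j} \<noteq> {}" using refl[OF that] by blast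
    then show ?thesis using le_cINF_iff[OF _ bdd] by auto
  qed
  have g_le: "?g i \<le> 1" if "i \<in> D" for i
    using that f by (intro cINF_lower2[OF bdd refl]) auto
  have bdd': "bdd_above (?g ` D)"
    by (rule bdd_aboveI2[where M = 1]) (use g_le in auto)
  show ?thesis
  proof
    assume sup: "(SUP i\<in>D. ?g i) = 1"
    show "\<forall>r\<in>{0..<1}. \<exists>i\<in>D. \<forall>j\<in>D. le i j \<longrightarrow> r \<le> f j"
    proof
      fix r :: real assume "r \<in> {0..<1}"
      then have "r < (SUP i\<in>D. ?g i)" using sup by simp
      then obtain i where "i \<in> D" "r < ?g i" using less_cSUP_iff[OF ne bdd'] by blast
      then show "\<exists>i\<in>D. \<forall>j\<in>D. le i j \<longrightarrow> r \<le> f j" using INF_iff[of i r] by force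
    qed
  next
    assume conv: "\<forall>r\<in>{0..<1}. \<exists>i\<in>D. \<forall>j\<in>D. le i j \<longrightarrow> r \<le> f j"
    have "r \<le> (SUP i\<in>D. ?g i)" if r: "r \<in> {0..<1}" for r :: real
    proof -
      obtain i where "i \<in> D" "r \<le> ?g i" using conv r INF_iff by meson
      then show ?thesis using cSUP_upper2[OF bdd'] by blast
    qed
    then have "1 \<le> (SUP i\<in>D. ?g i)" by (rule dense_le_bounded[of 0, rotated]) auto
    moreover have "(SUP i\<in>D. ?g i) \<le> 1" using ne g_le by (rule cSUP_least)
    ultimately show "(SUP i\<in>D. ?g i) = 1" by simp
  qed
qed

theorem proposition3p8:
  fixes D :: "'i set" and le :: "'i \<Rightarrow> 'i \<Rightarrow> bool"
    and U :: "'i \<Rightarrow> real \<Rightarrow> real" and u :: "real \<Rightarrow> real"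
  assumes "directed_set D le"
    and "\<And>i. i \<in> D \<Longrightarrow> U i \<in> fuzzy_numbers"
    and "u \<in> fuzzy_numbers"
  shows "S_converges D le U u \<longleftrightarrow>
    (\<forall>\<epsilon>>0. \<exists>i0\<in>D. \<forall>i\<in>D. le i0 i \<longrightarrow>
      (\<forall>x. (U i x = 0 \<and> u x = 0) \<or>
           min (U i x) (u x) / max (U i x) (u x) > 1 - \<epsilon>))"
proof -
  have "S_converges D le U u \<longleftrightarrow>
      (\<forall>r\<in>{0..<1}. \<exists>i\<in>D. \<forall>j\<in>D. le i j \<longrightarrow> r \<le> fuzzy_S u (U j))"
    unfolding S_converges_def
    by (rule SUP_INF_eq_1_iff[OF assms(1) fuzzy_S_range[OF assms(3) assms(2)]])
  also have "\<dots> \<longleftrightarrow> (\<forall>r\<in>{0..<1}. \<exists>i0\<in>D. \<forall>i\<in>D. le i0 i \<longrightarrow>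
      (\<forall>x. r * u x \<le> U i x \<and> r * U i x \<le> u x))" (is "_ \<longleftrightarrow> ?mult")
    using le_fuzzy_S_iff[OF assms(3) assms(2)] by (simp cong: conj_cong)
  also have "\<dots> \<longleftrightarrow> (\<forall>\<epsilon>>0. \<exists>i0\<in>D. \<forall>i\<in>D. le i0 i \<longrightarrow>
      (\<forall>x. (U i x = 0 \<and> u x = 0) \<or>
           min (U i x) (u x) / max (U i x) (u x) > 1 - \<epsilon>))" (is "_ \<longleftrightarrow> ?quot")
  proof
    assume mult: ?mult
    show ?quot
    proof (intro allI impI)
      fix \<epsilon> :: real assume "\<epsilon> > 0"
      \<comment> \<open>Any \<open>r\<close> in \<open>[0,1)\<close> strictly above \<open>1 - \<epsilon>\<close> makes the strict inequality follow.\<close>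
      define r where "r = max 0 (1 - \<epsilon> / 2)"
      have r: "r \<in> {0..<1}" "1 - \<epsilon> < r" using \<open>\<epsilon> > 0\<close> by (auto simp: r_def)
      obtain i0 where i0: "i0 \<in> D"
          "\<And>i x. i \<in> D \<Longrightarrow> le i0 i \<Longrightarrow> r * u x \<le> U i x \<and> r * U i x \<le> u x"
        using mult r(1) by meson
      have "(U i x = 0 \<and> u x = 0) \<or> min (U i x) (u x) / max (U i x) (u x) > 1 - \<epsilon>"
        if i: "i \<in> D" "le i0 i" for i x
      proof (cases "U i x = 0 \<and> u x = 0")
        case False
        then have pos: "max (U i x) (u x) > 0"
          using fuzzy_number_range(1)[OF assms(2)[OF i(1)], of x]
            fuzzy_number_range(1)[OF assms(3), of x] by (auto simp: less_max_iff_disj)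
        have "r * max (U i x) (u x) \<le> min (U i x) (u x)"
        proof -
          have "r * U i x \<le> U i x" "r * u x \<le> u x"
            using r(1) fuzzy_number_range(1)[OF assms(2)[OF i(1)], of x]
              fuzzy_number_range(1)[OF assms(3), of x] by (auto intro: mult_left_le_one_le)
          then show ?thesis using i0(2)[OF i, of x] by (simp add: max_def)
        qed
        then have "r \<le> min (U i x) (u x) / max (U i x) (u x)"
          using pos by (simp add: pos_le_divide_eq)
        then show ?thesis using r(2) by linarith
      qed simp
      then show "\<exists>i0\<in>D. \<forall>i\<in>D. le i0 i \<longrightarrow> (\<forall>x. (U i x = 0 \<and> u x = 0) \<or>
          min (U i x) (u x) / max (U i x) (u x) > 1 - \<epsilon>)"
        using i0(1) by blast
    qed
  next
    assume quot: ?quot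
    show ?mult
    proof
      fix r :: real assume r: "r \<in> {0..<1}"
      then have "1 - r > 0" by simp
      then obtain i0 where i0: "i0 \<in> D" "\<And>i x. i \<in> D \<Longrightarrow> le i0 i \<Longrightarrow>
          (U i x = 0 \<and> u x = 0) \<or> min (U i x) (u x) / max (U i x) (u x) > 1 - (1 - r)"
        using quot by meson
      have "r * u x \<le> U i x \<and> r * U i x \<le> u x" if i: "i \<in> D" "le i0 i" for i x
      proof (cases "U i x = 0 \<and> u x = 0")
        case False
        then have pos: "max (U i x) (u x) > 0"
          using fuzzy_number_range(1)[OF assms(2)[OF i(1)], of x]
            fuzzy_number_range(1)[OF assms(3), of x] by (auto simp: less_max_iff_disj)
        have "r < min (U i x) (u x) / max (U i x) (u x)" using i0(2)[OF i, of x] False by simp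
        then have "r * max (U i x) (u x) < min (U i x) (u x)"
          using pos by (simp add: pos_less_divide_eq)
        moreover have "r * u x \<le> r * max (U i x) (u x)" "r * U i x \<le> r * max (U i x) (u x)"
          using r by (auto intro!: mult_left_mono)
        ultimately show ?thesis by simp
      qed simp
      then show "\<exists>i0\<in>D. \<forall>i\<in>D. le i0 i \<longrightarrow> (\<forall>x. r * u x \<le> U i x \<and> r * U i x \<le> u x)"
        using i0(1) by blast
    qed
  qed
  finally show ?thesis .
qed

end
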